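(* Let $m, n \geq 3$ be integers with $m$ odd. Then the integer $$G_{m,n} = \left[ \prod_{i=1}^{(m-1)/2} \left(\alpha_i^{n/2} - \alpha_i^{-n/2}\right) \right]^2$$ is composite, where $\alpha_i, \alpha_i^{-1}$ ($i = 1, \ldots, (m-1)/2$) are the roots of the polynomial $d_m(x)$ defined in the context.
   Context: For $m \geq 2$ let $\mathbf{A}_m$ be the $m \times m$ integer matrix of the linear map $(x_1,\ldots,x_m) \mapsto (y_1,\ldots,y_m)$ (acting on column vectors) that describes how Fox colors propagate, via the rule $2(\text{over}) - (\text{under}) - (\text{under}) = 0$, through one block $\sigma_1\sigma_2^{-1}\sigma_3\cdots$ of the alternating $m$-strand braid. Explicitly: put $z_1 = x_1$, and for $i = 1, \ldots, m-1$ set - if $i$ is odd: $y_i = 2 z_i - x_{i+1}$ and $z_{i+1} = z_i$; - if $i$ is even: $y_i = x_{i+1}$ and $z_{i+1} = 2x_{i+1} - z_i$; and finally $y_m = z_m$. For example, $$\mathbf{A}_2 = \begin{pmatrix} 2 & -1 \\ 1 & 0 \end{pmatrix}, \quad \mathbf{A}_3 = \begin{pmatrix} 2 & -1 & 0 \\ 0 & 0 & 1 \\ -1 & 0 & 2 \end{pmatrix}, \quad \mathbf{A}_4 = \begin{pmatrix} 2 & -1 & 0 & 0 \\ 0 & 0 & 1 & 0 \\ -2 & 0 & 4 & -1 \\ -1 & 0 & 2 & 0 \end{pmatrix}.$$ Let $g_m(x) = \det(\mathbf{A}_m - xI)$ be the characteristic polynomial. It is divisible by $1-x$, and $d_m(x)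 = g_m(x)/(1-x)$. For example $d_2 = 1-x$, $d_3 = 1-3x+x^2$, $d_4 = 1-5x+5x^2-x^3$, $d_5 = 1-7x+13x^2-7x^3+x^4$; the polynomials satisfy $d_{m+1} = (1-x)d_m - x\, d_{m-1}$ for $m \geq 3$. For $m$ odd, $d_m$ has degree $m-1$, all its roots are positive real numbers, and they come in reciprocal pairs $\alpha_i, \alpha_i^{-1}$, $i = 1, \ldots, (m-1)/2$. The powers $\alpha_i^{\pm n/2}$ are the positive real ones. *)

theory Defs
  imports Complex_Main "Jordan_Normal_Form.Determinant"
begin

(* Colors are indexed from 1; the value at index 0 is a dummy. *)
primrec fox_z :: "(nat \<Rightarrow> int) \<Rightarrow> nat \<Rightarrow> int" where
  "fox_z x 0 = 0"
| "fox_z x (Suc i) =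
     (if i = 0 then x 1
      else if odd i then fox_z x i
      else 2 * x (Suc i) - fox_z x i)"

definition fox_y :: "nat \<Rightarrow> (nat \<Rightarrow> int) \<Rightarrow> nat \<Rightarrow> int" where
  "fox_y m x i =
     (if i = m then fox_z x m
      else if odd i then 2 * fox_z x i - x (i + 1)
      else x (i + 1))"

(* Column j is the image of the j-th unit vector. Matrix indices start at 0,
   hence the shifts. *)
definition fox_matrix :: "nat \<Rightarrow> int mat" where
  "fox_matrix m =
     mat m m (\<lambda>(i, j). fox_y m (\<lambda>k. if k = j + 1 then 1 else 0) (i + 1))"

(* The sign convention is det (A - x I), which differs from the library's
   char_poly, det (x I - A), by a factor (-1)^m. *)
definition fox_g :: "nat \<Rightarrow> int poly" where
  "fox_g m = det (map_mat (\<lambda>a. [:a:]) (fox_matrix m) - [:0, 1:] \<cdot>\<^sub>m 1\<^sub>m m)"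

(* [:1, -1:] is 1 - x; the division is exact for m >= 2. *)
definition fox_d :: "nat \<Rightarrow> int poly" where
  "fox_d m = fox_g m div [:1, -1:]"

end

theory Submission
  imports Defs "Jordan_Normal_Form.Schur_Decomposition"
begin

text \<open>
  Write \<open>m = 2 h + 1\<close>. The numbers \<open>w\<^sub>i = \<alpha>\<^sub>i + 1 / \<alpha>\<^sub>i\<close> are the roots of a monic integer
  polynomial \<open>Q\<close> of degree \<open>h\<close>, because \<open>d\<^sub>m\<close> is palindromic: \<open>d\<^sub>m(x) = x\<^sup>h Q(x + 1 / x)\<close>. Therefore
  the product of \<open>p(w\<^sub>i)\<close> over all \<open>i\<close> is an integer for every integer polynomial \<open>p\<close>
  (\<open>prod_poly_at_roots_Ints\<close>).

  The gap \<open>\<alpha>\<^sub>i\<^bsup>n/2\<^esup> - \<alpha>\<^sub>i\<^bsup>-n/2\<^esup>\<close> is divisible by the gap for the exponent \<open>1/2\<close>, or for the exponent \<open>1\<close> if \<open>n\<close>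
  is even, and the quotient is an integer polynomial in \<open>w\<^sub>i\<close> (\<open>power_gap_odd\<close>, \<open>power_gap_even\<close>).
  The squares of these two smallest gaps are \<open>w\<^sub>i - 2\<close> and \<open>(w\<^sub>i - 2) (w\<^sub>i + 2)\<close>. The product of all
  \<open>w\<^sub>i - 2\<close> is \<open>(-1)\<^sup>h d\<^sub>m(1) = 1\<close>. So the number in question is \<open>W N\<^sup>2\<close> with positive integers \<open>W\<close>
  (the product of all \<open>w\<^sub>i + 2\<close> if \<open>n\<close> is even, and \<open>1\<close> otherwise) and \<open>N\<close> (the product of the
  quotients). All \<open>\<alpha>\<^sub>i\<close> are positive, so \<open>w\<^sub>i \<ge> 2\<close>, and as \<open>n \<ge> 3\<close> every quotient is at least \<open>2\<close>
  (\<open>gap_quotient_ge\<close>). Thus \<open>N \<ge> 2\<close>, and \<open>W N\<^sup>2\<close> is composite.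

  The facts about \<open>d\<^sub>m\<close> that enter, namely the palindromic form, positivity of the real roots, the
  value at \<open>1\<close> and the degree, all follow from a recursion for odd \<open>m\<close>. The characteristic
  matrix is lower Hessenberg with units on the superdiagonal, so its determinant can be read off
  from the vector that solves all rows but the last (\<open>det_lower_hessenberg\<close>, \<open>fox_g_odd\<close>).
\<close>

section \<open>Determinants of lower Hessenberg matrices\<close>

text \<open>
  A vector \<open>v\<close> with \<open>v 0 = 1\<close> that solves all rows of \<open>H v = 0\<close> but the last can be computed from the
  top down whenever the superdiagonal is invertible. The column operation that replaces column
  \<open>0\<close> of \<open>H\<close> by \<open>H v\<close> has determinant \<open>v 0 = 1\<close>, and afterwards column \<open>0\<close> vanishes above the last
  row; the minor left after expansion is triangular with the superdiagonal of \<open>H\<close> on its diagonal.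
  Both the characteristic matrix of the Fox matrix and that of a companion matrix have this
  shape, with entries \<open>\<plusminus>1\<close> on the superdiagonal.
\<close>

lemma det_lower_hessenberg:
  fixes H :: "'a :: comm_ring_1 mat" and v :: "nat \<Rightarrow> 'a"
  assumes H: "H \<in> carrier_mat (Suc n) (Suc n)"
    and hess: "\<And>i j. Suc i < j \<Longrightarrow> j \<le> n \<Longrightarrow> H $$ (i, j) = 0"
    and v0: "v 0 = 1"
    and kernel: "\<And>i. i < n \<Longrightarrow> (\<Sum>j\<le>n. H $$ (i, j) * v j) = 0"
  shows "det H = (-1) ^ n * (\<Prod>i<n. H $$ (i, Suc i)) * (\<Sum>j\<le>n. H $$ (n, j) * v j)"
proof -
  \<comment> \<open>the matrix of the column operation\<close>
  define K where "K = mat (Suc n) (Suc n)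
    (\<lambda>(i, j). if j = 0 then v i else if i = j then 1 else 0)"
  have K: "K \<in> carrier_mat (Suc n) (Suc n)"
    by (simp add: K_def)
  have "det K = prod_list (diag_mat K)"
    by (rule det_lower_triangular[OF _ K]) (auto simp: K_def)
  also have "diag_mat K = replicate (Suc n) 1"
    by (rule nth_equalityI) (auto simp: diag_mat_def K_def v0 nth_Cons' simp del: upt_Suc)
  finally have detK: "det K = 1"
    by simp
  define N where "N = H * K"
  have N: "N \<in> carrier_mat (Suc n) (Suc n)"
    using H K by (simp add: N_def)
  have N0: "N $$ (i, 0) = (\<Sum>j\<le>n. H $$ (i, j) * v j)" if "i \<le> n" for i
    using that H K
    by (auto simp: N_def K_def scalar_prod_def atLeast0LessThan lessThan_Suc_atMost intro!: sum.cong)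
  have NSuc: "N $$ (i, Suc j) = H $$ (i, Suc j)" if "i \<le> n" "Suc j \<le> n" for i j
  proof -
    have "N $$ (i, Suc j) = (\<Sum>k<Suc n. H $$ (i, k) * (if k = Suc j then 1 else 0))"
      using that H K by (auto simp: N_def K_def scalar_prod_def atLeast0LessThan intro!: sum.cong)
    also have "\<dots> = H $$ (i, Suc j)"
      using that by (simp add: if_distrib[of "(*) _"] sum.delta cong: if_cong)
    finally show ?thesis .
  qed
  define L where "L = mat_delete N n 0"
  have L: "L \<in> carrier_mat n n"
    using N by (simp add: L_def mat_delete_def)
  have L_entry: "L $$ (i, j) = H $$ (i, Suc j)" if "i < n" "j < n" for i j
    using that N NSuc by (simp add: L_def mat_delete_def)
  have "det L = prod_list (diag_mat L)"
    by (rule det_lower_triangular[OF _ L]) (use L_entry hess in auto)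
  also have "\<dots> = (\<Prod>i<n. L $$ (i, i))"
    using L by (simp add: diag_mat_def prod.list_conv_set_nth atLeast0LessThan)
  also have "\<dots> = (\<Prod>i<n. H $$ (i, Suc i))"
    by (intro prod.cong) (simp_all add: L_entry)
  finally have detL: "det L = (\<Prod>i<n. H $$ (i, Suc i))" .
  have "det H = det N"
    using det_mult[OF H K] by (simp add: N_def detK)
  also have "\<dots> = (\<Sum>i<Suc n. N $$ (i, 0) * cofactor N i 0)"
    by (rule laplace_expansion_column[OF N]) simp
  also have "\<dots> = N $$ (n, 0) * cofactor N n 0"
    using N0 kernel by simp
  also have "\<dots> = (\<Sum>j\<le>n. H $$ (n, j) * v j) * ((-1) ^ n * det L)"
    by (simp add: N0 cofactor_def L_def)
  finally show ?thesis
    by (simp add: detL mult_ac)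
qed

section \<open>The Fox polynomials of odd index\<close>

text \<open>
  This is the sequence \<open>d\<^bsub>2 h + 1\<^esub>\<close>. Its recursion comes from applying
  \<open>d\<^bsub>m + 1\<^esub> = (1 - x) d\<^sub>m - x d\<^bsub>m - 1\<^esub>\<close> twice, so that the polynomials of even index disappear.
\<close>

fun odd_d :: "nat \<Rightarrow> int poly" where
  "odd_d 0 = 1"
| "odd_d (Suc 0) = [:1, -3, 1:]"
| "odd_d (Suc (Suc h)) = [:1, -4, 1:] * odd_d (Suc h) - [:0, 0, 1:] * odd_d h"

text \<open>
  Let the color \<open>1\<close> enter at the first position and require that at every position but the last
  the outgoing color is \<open>x\<close> times the incoming one. The pair at \<open>k\<close> consists of the incoming
  color \<open>x\<^bsub>2 k + 1\<^esub>\<close> and the running color \<open>z\<^bsub>2 k + 1\<^esub>\<close>, in the notation of the propagation rule.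
\<close>

primrec eigen_colors :: "nat \<Rightarrow> int poly \<times> int poly" where
  "eigen_colors 0 = (1, 1)"
| "eigen_colors (Suc k) = (let a = [:0, 1:] * (2 * snd (eigen_colors k) - [:0, 1:] * fst (eigen_colors k))
                   in (a, 2 * a - snd (eigen_colors k)))"

text \<open>
  The left-hand side is the failure of the eigenvector equation at the last position, which is the
  characteristic polynomial up to sign. One step of \<open>eigen_colors\<close> is a linear map of the pair
  with trace \<open>-(x\<^sup>2 - 4 x + 1)\<close> and determinant \<open>x\<^sup>2\<close>; by Cayley--Hamilton the failure obeys
  the same recursion as \<open>odd_d\<close>, up to the alternating sign.
\<close>

lemma eigen_colors_defect:
  "snd (eigen_colors k) - [:0, 1:] * fst (eigen_colors k) = (-1) ^ k * ([:1, -1:] * odd_d k)"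
proof (induction k rule: odd_d.induct)
  case 1
  show ?case by (simp add: one_pCons)
next
  case 2
  show ?case by (simp add: one_pCons numeral_poly)
next
  case (3 h)
  define X :: "int poly" where "X = [:0, 1:]"
  have c: "[:1, -4, 1:] = 1 - 4 * X + X * X" "[:0, 0, 1:] = X * X"
    by (simp_all add: X_def numeral_poly one_pCons)
  define L :: "int poly" where "L = [:1, -1:]"
  define D where "D k = snd (eigen_colors k) - X * fst (eigen_colors k)" for k
  have "D (Suc (Suc h)) = - ((1 - 4 * X + X * X) * D (Suc h)) - X * X * D h"
    unfolding D_def eigen_colors.simps Let_def fst_conv snd_conv X_def[symmetric]
    by (simp add: algebra_simps)
  also have "D (Suc h) = (-1) ^ Suc h * (L * odd_d (Suc h))"
    using 3(1) by (simp only: D_def X_def L_def)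
  also have "D h = (-1) ^ h * (L * odd_d h)"
    using 3(2) by (simp only: D_def X_def L_def)
  also have "- ((1 - 4 * X + X * X) * ((-1) ^ Suc h * (L * odd_d (Suc h))))
      - X * X * ((-1) ^ h * (L * odd_d h))
      = (-1) ^ Suc (Suc h) * (L * odd_d (Suc (Suc h)))"
    unfolding odd_d.simps c by (simp add: algebra_simps)
  finally show ?case
    by (simp only: D_def X_def L_def)
qed

lemma fox_z_before: "i \<le> j \<Longrightarrow> fox_z (\<lambda>k. if k = Suc j then 1 else 0) i = 0"
  by (induction i) auto

lemma fox_g_odd:
  "fox_g (Suc (2 * h)) = [:1, -1:] * odd_d h"
proof -
  define n where "n = 2 * h"
  define e :: "nat \<Rightarrow> nat \<Rightarrow> int" where "e j = (\<lambda>k. if k = Suc j then 1 else 0)" for j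
  \<comment> \<open>the kernel vector of the first \<open>n\<close> rows; the even indices carry the colors \<open>x\<^bsub>2 k + 1\<^esub>\<close>,
    because matrix indices start at \<open>0\<close> and colors at \<open>1\<close>\<close>
  define v where "v i = (if even i then fst (eigen_colors (i div 2))
     else 2 * snd (eigen_colors (i div 2)) - [:0, 1:] * fst (eigen_colors (i div 2)))" for i
  \<comment> \<open>the running color produced by the incoming colors \<open>v\<close>; since \<open>fox_z\<close> is integer valued, it is
    extended to polynomial colors by linearity\<close>
  define Z where "Z i = (\<Sum>j\<le>n. [:fox_z (e j) i:] * v j)" for i
  define H where "H = map_mat (\<lambda>a. [:a:]) (fox_matrix (Suc n)) - [:0, 1:] \<cdot>\<^sub>m 1\<^sub>m (Suc n)"
  have H: "H \<in> carrier_mat (Suc n) (Suc n)"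
    unfolding H_def by (intro minus_carrier_mat) simp
  have entry: "H $$ (i, j) = [:fox_y (Suc n) (e j) (Suc i):] - (if i = j then [:0, 1:] else 0)"
    if "i \<le> n" "j \<le> n" for i j
    using that by (simp add: H_def fox_matrix_def e_def one_pCons)
  have coord: "(\<Sum>j\<le>n. [:e j (Suc i):] * v j) = v i" if "i \<le> n" for i
  proof -
    have "(\<Sum>j\<le>n. [:e j (Suc i):] * v j) = (\<Sum>j\<le>n. if i = j then v j else 0)"
      by (intro sum.cong) (auto simp: e_def)
    then show ?thesis using that by simp
  qed
  have Z: "Z (Suc i) = snd (eigen_colors (i div 2))" if "i \<le> n" for i
    using that
  proof (induction i)
    case 0
    then show ?case using coord[of 0] by (simp add: Z_def v_def)
  next
    case (Suc i)
    show ?case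
    proof (cases "even i")
      case True
      then have "Z (Suc (Suc i)) = Z (Suc i)" by (simp add: Z_def)
      with Suc True show ?thesis by simp
    next
      case False
      have "Z (Suc (Suc i)) = (\<Sum>j\<le>n. 2 * ([:e j (Suc (Suc i)):] * v j) - [:fox_z (e j) (Suc i):] * v j)"
        unfolding Z_def using False
        by (intro sum.cong) (auto simp: numeral_poly algebra_simps simp flip: smult_diff_left)
      also have "\<dots> = 2 * v (Suc i) - Z (Suc i)"
        by (simp only: sum_subtractf Z_def sum_distrib_left[symmetric] coord[OF Suc.prems])
      finally show ?thesis
        using Suc False by (auto simp: v_def elim!: oddE)
    qed
  qed
  have row: "(\<Sum>j\<le>n. H $$ (i, j) * v j)
      = (\<Sum>j\<le>n. [:fox_y (Suc n) (e j) (Suc i):] * v j) - [:0, 1:] * v i" if "i \<le> n" for i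
  proof -
    have "(\<Sum>j\<le>n. H $$ (i, j) * v j) = (\<Sum>j\<le>n. [:fox_y (Suc n) (e j) (Suc i):] * v j
        - (if i = j then [:0, 1:] * v j else 0))"
      using that by (intro sum.cong) (auto simp: entry algebra_simps)
    also have "\<dots> = (\<Sum>j\<le>n. [:fox_y (Suc n) (e j) (Suc i):] * v j) - [:0, 1:] * v i"
      using that by (simp add: sum_subtractf)
    finally show ?thesis .
  qed
  have kernel: "(\<Sum>j\<le>n. H $$ (i, j) * v j) = 0" if "i < n" for i
  proof (cases "even i")
    case True
    have "(\<Sum>j\<le>n. [:fox_y (Suc n) (e j) (Suc i):] * v j)
        = (\<Sum>j\<le>n. 2 * ([:fox_z (e j) (Suc i):] * v j) - [:e j (Suc (Suc i)):] * v j)"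
      using that True
      by (intro sum.cong) (auto simp: fox_y_def numeral_poly algebra_simps simp flip: smult_diff_left)
    also have "\<dots> = 2 * Z (Suc i) - v (Suc i)"
      using that by (simp only: sum_subtractf Z_def sum_distrib_left[symmetric] coord Suc_le_eq)
    finally show ?thesis
      using row[of i] Z[of i] that True by (auto simp: v_def elim!: evenE)
  next
    case False
    have "(\<Sum>j\<le>n. [:fox_y (Suc n) (e j) (Suc i):] * v j) = v (Suc i)"
      using coord[of "Suc i"] that False by (simp add: fox_y_def)
    then show ?thesis
      using row[of i] that False by (auto simp: v_def Let_def elim!: oddE)
  qed
  have "(\<Sum>j\<le>n. H $$ (n, j) * v j) = Z (Suc n) - [:0, 1:] * v n"
    using row[of n] by (simp add: fox_y_def Z_def)
  also have "\<dots> = (-1) ^ h * ([:1, -1:] * odd_d h)"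
    using Z[of n] eigen_colors_defect[of h] by (simp add: v_def n_def)
  finally have last: "(\<Sum>j\<le>n. H $$ (n, j) * v j) = (-1) ^ h * ([:1, -1:] * odd_d h)" .
  have superdiag: "H $$ (i, Suc i) = (if even i then - 1 else 1)" if "i < n" for i
    using that fox_z_before[of "Suc i" "Suc i"]
    by (auto simp: entry fox_y_def e_def one_pCons)
  have prod_superdiag: "(\<Prod>i<2 * k. if even i then - 1 else 1) = ((-1) ^ k :: int poly)" for k
    by (induction k) auto
  have "det H = (-1) ^ n * (\<Prod>i<n. H $$ (i, Suc i)) * (\<Sum>j\<le>n. H $$ (n, j) * v j)"
  proof (rule det_lower_hessenberg[OF H])
    show "H $$ (i, j) = 0" if "Suc i < j" "j \<le> n" for i j
      using that fox_z_before[of "Suc i" j] by (simp add: entry fox_y_def e_def)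
    show "v 0 = 1" by (simp add: v_def)
  qed (fact kernel)
  also have "(\<Prod>i<n. H $$ (i, Suc i)) = (-1) ^ h"
    using superdiag prod_superdiag[of h] by (simp add: n_def)
  finally have "fox_g (Suc (2 * h)) = (-1) ^ n * (-1) ^ h * ((-1) ^ h * ([:1, -1:] * odd_d h))"
    unfolding last by (simp only: fox_g_def H_def n_def)
  then show ?thesis
    by (simp add: n_def flip: mult.assoc power_mult_distrib)
qed

lemma fox_d_odd: "fox_d (Suc (2 * h)) = odd_d h"
  unfolding fox_d_def fox_g_odd by (rule nonzero_mult_div_cancel_left) simp

section \<open>Products of integer polynomials over the roots of an integer polynomial\<close>

text \<open>
  The kernel vector for the Hessenberg determinant is \<open>(1, x, \<dots>, x\<^sup>k)\<close>: the shift rows annihilate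
  it, and the last row evaluates the polynomial.
\<close>

lemma char_poly_companion:
  fixes p :: "'a :: comm_ring_1 poly"
  assumes deg: "degree p = Suc k" and monic: "lead_coeff p = 1"
  defines "C \<equiv> mat (Suc k) (Suc k)
    (\<lambda>(i, j). if i = k then - coeff p j else if j = Suc i then 1 else 0)"
  shows "char_poly C = p"
proof -
  define H where "H = char_poly_matrix C"
  have C: "C \<in> carrier_mat (Suc k) (Suc k)"
    by (simp add: C_def)
  have H: "H \<in> carrier_mat (Suc k) (Suc k)"
    unfolding H_def by (rule char_poly_matrix_closed[OF C])
  have entry: "H $$ (i, j) = (if i = j then monom 1 1 else 0)
      + (if i = k then [:coeff p j:] else if j = Suc i then - 1 else 0)"
    if "i \<le> k" "j \<le> k" for i j
    using that by (auto simp: H_def char_poly_matrix_def C_def monom_altdef one_pCons)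
  have row: "(\<Sum>j\<le>k. H $$ (i, j) * monom 1 j) = monom 1 (Suc i)
      + (\<Sum>j\<le>k. (if i = k then [:coeff p j:] else if j = Suc i then - 1 else 0) * monom 1 j)"
    if "i \<le> k" for i
  proof -
    have "(\<Sum>j\<le>k. H $$ (i, j) * monom 1 j) = (\<Sum>j\<le>k. (if i = j then monom 1 (Suc i) else 0)
      + (if i = k then [:coeff p j:] else if j = Suc i then - 1 else 0) * monom 1 j)"
      using that by (intro sum.cong) (auto simp: entry distrib_right mult_monom)
    then show ?thesis
      using that by (simp add: sum.distrib)
  qed
  have kernel: "(\<Sum>j\<le>k. H $$ (i, j) * monom 1 j) = 0" if "i < k" for i
  proof -
    have "(\<Sum>j\<le>k. (if j = Suc i then - 1 else 0) * monom 1 j)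
        = (\<Sum>j\<le>k. if j = Suc i then - monom 1 j else (0 :: 'a poly))"
      by (intro sum.cong) auto
    then show ?thesis using row[of i] that by simp
  qed
  have "(\<Sum>j\<le>k. H $$ (k, j) * monom 1 j) = monom 1 (Suc k) + (\<Sum>j\<le>k. monom (coeff p j) j)"
    using row[of k] by (simp add: smult_monom)
  also have "\<dots> = (\<Sum>j\<le>Suc k. monom (coeff p j) j)"
    using deg monic by simp
  also have "\<dots> = p"
    using poly_as_sum_of_monoms[of p] deg by simp
  finally have last: "(\<Sum>j\<le>k. H $$ (k, j) * monom 1 j) = p" .
  have "det H = (-1) ^ k * (\<Prod>i<k. H $$ (i, Suc i)) * (\<Sum>j\<le>k. H $$ (k, j) * monom 1 j)"
  proof (rule det_lower_hessenberg[OF H])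
    show "H $$ (i, j) = 0" if "Suc i < j" "j \<le> k" for i j
      using that by (simp add: entry)
    show "monom 1 0 = (1 :: 'a poly)" by simp
  qed (fact kernel)
  also have "(\<Prod>i<k. H $$ (i, Suc i)) = (-1) ^ k"
    by (simp add: entry)
  finally have "char_poly C = (-1) ^ k * (-1) ^ k * p"
    unfolding last by (simp only: char_poly_def H_def)
  then show ?thesis
    by (simp flip: power_mult_distrib)
qed

text \<open>
  Here \<open>M = p(C)\<close> and \<open>T = p(B)\<close>, built up by the Horner scheme. The point is that one and the
  same matrix is integral in the basis of \<open>C\<close> and triangular in the basis of \<open>B\<close>.
\<close>

lemma poly_of_similar_upper_triangular:
  fixes C :: "int mat" and B S S' :: "real mat" and p :: "int poly"
  assumes C: "C \<in> carrier_mat n n" and B: "B \<in> carrier_mat n n"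
    and S: "S \<in> carrier_mat n n" and S': "S' \<in> carrier_mat n n"
    and inv: "S * S' = 1\<^sub>m n" "S' * S = 1\<^sub>m n"
    and sim: "map_mat real_of_int C = S * B * S'"
    and ut: "upper_triangular B"
  shows "\<exists>M \<in> carrier_mat n n. \<exists>T \<in> carrier_mat n n. map_mat real_of_int M = S * T * S' \<and>
    upper_triangular T \<and> (\<forall>i<n. T $$ (i, i) = poly (of_int_poly p) (B $$ (i, i)))"
proof (induction p)
  case 0
  show ?case
    by (rule bexI[of _ "0\<^sub>m n n"], rule bexI[of _ "0\<^sub>m n n"])
      (use S S' in auto)
next
  case (pCons a p)
  then obtain M T where M: "M \<in> carrier_mat n n" and T: "T \<in> carrier_mat n n"
    and MT: "map_mat real_of_int M = S * T * S'" and utT: "upper_triangular T"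
    and diagT: "\<And>i. i < n \<Longrightarrow> T $$ (i, i) = poly (of_int_poly p) (B $$ (i, i))"
    by blast
  define M' where "M' = a \<cdot>\<^sub>m 1\<^sub>m n + C * M"
  define T' where "T' = real_of_int a \<cdot>\<^sub>m 1\<^sub>m n + B * T"
  have M': "M' \<in> carrier_mat n n" and T': "T' \<in> carrier_mat n n"
    using C M B T by (simp_all add: M'_def T'_def)
  have "map_mat real_of_int M' = real_of_int a \<cdot>\<^sub>m 1\<^sub>m n + map_mat real_of_int (C * M)"
    using C M by (intro eq_matI) (auto simp: M'_def)
  also have "map_mat real_of_int (C * M) = (S * B * S') * (S * T * S')"
    using of_int_hom.mat_hom_mult[OF C M, where 'a = real] by (simp add: MT sim)
  also have "\<dots> = S * B * (S' * S) * (T * S')"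
    using S S' B T by (simp add: assoc_mult_mat[of _ n n _ n _ n])
  also have "\<dots> = S * (B * T) * S'"
    using S S' B T by (simp add: inv assoc_mult_mat[of _ n n _ n _ n])
  also have "real_of_int a \<cdot>\<^sub>m 1\<^sub>m n = S * (real_of_int a \<cdot>\<^sub>m 1\<^sub>m n) * S'"
    using S S' by (simp add: inv mult_smult_distrib[of _ n n _ n] mult_smult_assoc_mat[of _ n n _ n])
  also have "S * (real_of_int a \<cdot>\<^sub>m 1\<^sub>m n) * S' + S * (B * T) * S' = S * T' * S'"
    using S S' B T
    by (simp add: T'_def mult_add_distrib_mat[of _ n n _ n] add_mult_distrib_mat[of _ n n _ _ n])
  finally have eq: "map_mat real_of_int M' = S * T' * S'" .
  have entry: "(B * T) $$ (i, j) = (\<Sum>l = i..j. B $$ (i, l) * T $$ (l, j))" if "i < n" "j < n" for i j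
  proof -
    have "(B * T) $$ (i, j) = (\<Sum>l = 0..<n. B $$ (i, l) * T $$ (l, j))"
      using that B T by (simp add: scalar_prod_def)
    also have "\<dots> = (\<Sum>l = i..j. B $$ (i, l) * T $$ (l, j))"
    proof (rule sum.mono_neutral_right)
      show "\<forall>l \<in> {0..<n} - {i..j}. B $$ (i, l) * T $$ (l, j) = 0"
        using upper_triangularD[OF ut] upper_triangularD[OF utT] that B T by auto
    qed (use that in auto)
    finally show ?thesis .
  qed
  have "upper_triangular T'"
    using T' B T entry by (intro upper_triangularI) (auto simp: T'_def)
  moreover have "T' $$ (i, i) = poly (of_int_poly (pCons a p)) (B $$ (i, i))" if "i < n" for i
    using that B T entry[OF that that] diagT[OF that]
    by (simp add: T'_def of_int_hom.map_poly_pCons_hom)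
  ultimately show ?case
    using M' T' eq by blast
qed

text \<open>
  The product is the determinant of \<open>p(C)\<close> for the companion matrix \<open>C\<close> of \<open>q\<close> (the resultant of \<open>q\<close>
  and \<open>p\<close>): \<open>C\<close> has integer entries, and after a Schur decomposition its diagonal is \<open>ws\<close>.
  Multiple roots are covered, since nothing has to be diagonalized.
\<close>

lemma prod_poly_at_roots_Ints:
  fixes p q :: "int poly" and ws :: "real list"
  assumes q: "of_int_poly q = (\<Prod>w\<leftarrow>ws. [:-w, 1:])"
  shows "(\<Prod>w\<leftarrow>ws. poly (of_int_poly p) w) \<in> \<int>"
proof (cases "length ws")
  case 0
  then show ?thesis by simp
next
  case (Suc k)
  have deg: "degree q = Suc k" and monic: "lead_coeff q = 1"
  proof -
    have "degree (of_int_poly q :: real poly) = Suc k"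
      unfolding q using Suc by (simp add: degree_linear_factors)
    then show "degree q = Suc k" by simp
    have "lead_coeff (of_int_poly q :: real poly) = 1"
      unfolding q by (rule monic_prod_list) auto
    then show "lead_coeff q = 1" by simp
  qed
  define n where "n = Suc k"
  obtain C where C: "C \<in> carrier_mat n n" and cp: "char_poly C = q"
    by (rule that[OF _ char_poly_companion[OF deg monic]]) (simp add: n_def)
  define R where "R = map_mat real_of_int C"
  have R: "R \<in> carrier_mat n n"
    using C by (simp add: R_def)
  have cpR: "char_poly R = (\<Prod>w\<leftarrow>ws. [:-w, 1:])"
    using of_int_hom.char_poly_hom[OF C, where 'a = real] by (simp add: R_def cp q)
  obtain B S S' where schur: "schur_decomposition R ws = (B, S, S')"
    by (cases "schur_decomposition R ws") auto
  from schur_decomposition[OF R cpR schur]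
  have wit: "similar_mat_wit R B S S'" and ut: "upper_triangular B" and diag: "diag_mat B = ws"
    by auto
  note wit = similar_mat_witD2[OF R wit]
  obtain M T where M: "M \<in> carrier_mat n n" and T: "T \<in> carrier_mat n n"
    and MT: "map_mat real_of_int M = S * T * S'" and utT: "upper_triangular T"
    and diagT: "\<forall>i<n. T $$ (i, i) = poly (of_int_poly p) (B $$ (i, i))"
    using poly_of_similar_upper_triangular[OF C wit(5,6,7,1,2) wit(3)[unfolded R_def] ut] by blast
  have "(\<Prod>w\<leftarrow>ws. poly (of_int_poly p) w) = prod_list (diag_mat T)"
  proof -
    have "map (poly (of_int_poly p)) ws = diag_mat T"
      unfolding diag[symmetric] using wit(5) T diagT by (auto simp: diag_mat_def)
    then show ?thesis by simp
  qed
  also have "\<dots> = det T"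
    by (rule det_upper_triangular[OF utT T, symmetric])
  also have "\<dots> = det (map_mat real_of_int M)"
    by (rule det_similar[OF similar_matI[where P = S and Q = S' and n = n], symmetric]) (use M T MT wit in auto)
  also have "\<dots> = real_of_int (det M)"
    by (rule of_int_hom.hom_det)
  finally show ?thesis by simp
qed

section \<open>The polynomials of the traces\<close>

text \<open>
  The monic integer polynomial whose roots are the traces \<open>\<alpha> + 1 / \<alpha>\<close> of the reciprocal pairs
  of roots of \<open>odd_d h\<close>: dividing the recursion of \<open>odd_d\<close> by \<open>x ^ (h + 2)\<close> turns the factor
  \<open>x\<^sup>2 - 4 x + 1\<close> into \<open>x + 1 / x - 4\<close> and \<open>x\<^sup>2\<close> into \<open>1\<close>.
\<close>

fun trace_poly :: "nat \<Rightarrow> int poly" where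
  "trace_poly 0 = 1"
| "trace_poly (Suc 0) = [:-3, 1:]"
| "trace_poly (Suc (Suc h)) = [:-4, 1:] * trace_poly (Suc h) - trace_poly h"

lemma poly_odd_d_Suc_Suc:
  "poly (of_int_poly (odd_d (Suc (Suc h)))) (x :: real)
    = (1 - 4 * x + x\<^sup>2) * poly (of_int_poly (odd_d (Suc h))) x
      - x\<^sup>2 * poly (of_int_poly (odd_d h)) x"
  by (simp only: odd_d.simps of_int_poly_hom.hom_mult of_int_poly_hom.hom_minus poly_mult poly_diff)
    (simp add: of_int_hom.map_poly_pCons_hom algebra_simps power2_eq_square)

lemma poly_trace_poly_Suc_Suc:
  "poly (of_int_poly (trace_poly (Suc (Suc h)))) (y :: real)
    = (y - 4) * poly (of_int_poly (trace_poly (Suc h))) y - poly (of_int_poly (trace_poly h)) y"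
  by (simp only: trace_poly.simps of_int_poly_hom.hom_mult of_int_poly_hom.hom_minus poly_mult poly_diff)
    (simp add: of_int_hom.map_poly_pCons_hom algebra_simps power2_eq_square)

lemma odd_d_eq_trace_poly:
  fixes x :: real
  assumes "x \<noteq> 0"
  shows "poly (of_int_poly (odd_d h)) x = x ^ h * poly (of_int_poly (trace_poly h)) (x + inverse x)"
proof (induction h rule: odd_d.induct)
  case 1
  show ?case by simp
next
  case 2
  show ?case using assms by (simp add: of_int_hom.map_poly_pCons_hom field_simps)
next
  case (3 h)
  define y where "y = x + inverse x"
  have quad: "1 - 4 * x + x\<^sup>2 = x * (y - 4)"
    using assms by (simp add: y_def field_simps power2_eq_square)
  show ?case
    unfolding poly_odd_d_Suc_Suc poly_trace_poly_Suc_Suc 3 quad y_def[symmetric]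
    by (simp add: algebra_simps power2_eq_square del: odd_d.simps trace_poly.simps)
qed

lemma trace_poly_at_2: "poly (of_int_poly (trace_poly h)) (2 :: real) = (-1) ^ h"
proof (induction h rule: trace_poly.induct)
  case (3 h)
  then show ?case by (simp add: poly_trace_poly_Suc_Suc del: trace_poly.simps)
qed simp_all

text \<open>
  Writing \<open>e\<^sub>h\<close> for the value of \<open>odd_d h\<close> at \<open>x \<le> 0\<close>, the recursion reads
  \<open>e\<^bsub>h + 2\<^esub> - x\<^sup>2 e\<^bsub>h + 1\<^esub> = -4 x e\<^bsub>h + 1\<^esub> + (e\<^bsub>h + 1\<^esub> - x\<^sup>2 e\<^sub>h)\<close>, which is why positivity is
  carried along together with a lower bound for the next polynomial. Consequently all real
  roots are positive.
\<close>

lemma odd_d_pos: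
  fixes x :: real
  assumes "x \<le> 0"
  shows "poly (of_int_poly (odd_d h)) x > 0 \<and>
    poly (of_int_poly (odd_d (Suc h))) x > x\<^sup>2 * poly (of_int_poly (odd_d h)) x"
proof (induction h)
  case 0
  show ?case using assms by (auto simp: algebra_simps power2_eq_square)
next
  case (Suc h)
  let ?a = "poly (of_int_poly (odd_d h)) x" and ?b = "poly (of_int_poly (odd_d (Suc h))) x"
  have a: "?a > 0" and ab: "?b > x\<^sup>2 * ?a"
    using Suc by blast+
  have b: "?b > 0"
    using ab a by (smt (verit) mult_nonneg_nonneg zero_le_power2)
  have "poly (of_int_poly (odd_d (Suc (Suc h)))) x - x\<^sup>2 * ?b = (- 4 * x) * ?b + (?b - x\<^sup>2 * ?a)"
    unfolding poly_odd_d_Suc_Suc by (simp add: algebra_simps)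
  moreover have "(- 4 * x) * ?b \<ge> 0"
    using assms b by (intro mult_nonneg_nonneg[of "- 4 * x"]) auto
  ultimately show ?case
    using ab b by linarith
qed

lemma degree_odd_d: "degree (odd_d h) = 2 * h \<and> lead_coeff (odd_d h) = 1"
proof (induction h rule: odd_d.induct)
  case (3 h)
  let ?A = "[:1, -4, 1:] * odd_d (Suc h)" and ?B = "[:0, 0, 1:] * odd_d h"
  have nz: "odd_d h \<noteq> 0" "odd_d (Suc h) \<noteq> 0"
    using 3 by auto
  have degA: "degree ?A = 2 * Suc (Suc h)"
    using 3 nz by (subst degree_mult_eq) auto
  have lcA: "lead_coeff ?A = 1"
    by (subst lead_coeff_mult, subst conjunct2[OF 3(1)]) simp
  have degB: "degree ?B < degree ?A"
    unfolding degA using 3 nz by (subst degree_mult_eq) auto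
  have "degree (odd_d (Suc (Suc h))) = degree ?A"
    unfolding odd_d.simps diff_conv_add_uminus by (rule degree_add_eq_left, subst degree_minus, rule degB)
  moreover have "coeff ?B (degree ?A) = 0"
    by (rule coeff_eq_0[OF degB])
  ultimately show ?case
    using degA lcA by (simp only: odd_d.simps coeff_diff) simp
qed auto

lemma poly_eq_prod_proots:
  fixes p :: "'a :: field poly"
  assumes "p \<noteq> 0" and "size (proots p) = degree p"
  shows "p = smult (lead_coeff p) (\<Prod>a\<in>#proots p. [:-a, 1:])"
  using assms
proof (induction "degree p" arbitrary: p)
  case 0
  then show ?case by (auto elim!: degree_eq_zeroE)
next
  case (Suc n)
  then obtain a where "a \<in># proots p"
    by (metis multiset_nonemptyE nat.distinct(1) size_empty)
  then have "poly p a = 0"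
    using Suc.prems by (simp add: set_count_proots)
  then obtain q where pq: "p = [:-a, 1:] * q"
    by (auto simp: poly_eq_0_iff_dvd dvd_def)
  have q: "q \<noteq> 0"
    using pq Suc.prems by auto
  have roots: "proots p = {#a#} + proots q"
    unfolding pq using q by (subst proots_mult) auto
  have deg: "degree p = Suc (degree q)"
    unfolding pq using q by (subst degree_mult_eq) auto
  have step: "q = smult (lead_coeff q) (\<Prod>a\<in>#proots q. [:-a, 1:])"
    by (rule Suc.hyps(1)) (use Suc roots deg q in simp_all)
  have lc: "lead_coeff p = lead_coeff q"
    unfolding pq by (simp only: lead_coeff_mult) simp
  have "p = [:-a, 1:] * smult (lead_coeff q) (\<Prod>a\<in>#proots q. [:-a, 1:])"
    by (subst pq) (rule arg_cong[OF step])
  then show ?case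
    unfolding roots lc by (simp only: image_mset_union image_mset_single prod_mset.union
        prod_mset.singleton mult_smult_right)
qed

section \<open>Quotients of gaps between reciprocal powers\<close>

text \<open>
  For \<open>s t = 1\<close> and \<open>y = s\<^sup>2 + t\<^sup>2\<close> these Chebyshev-like polynomials in \<open>y\<close> are the quotients
  \<open>(s ^ n - t ^ n) / (s - t)\<close> for \<open>n = 2 k + 1\<close>, when \<open>c = 1\<close>, and
  \<open>(s ^ n - t ^ n) / (s\<^sup>2 - t\<^sup>2)\<close> for \<open>n = 2 k + 2\<close>, when \<open>c = 0\<close>.
\<close>

fun gap_quotient :: "int \<Rightarrow> nat \<Rightarrow> int poly" where
  "gap_quotient c 0 = 1"
| "gap_quotient c (Suc 0) = [:c, 1:]"
| "gap_quotient c (Suc (Suc k)) = [:0, 1:] * gap_quotient c (Suc k) - gap_quotient c k"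

lemma poly_gap_quotient_Suc_Suc:
  "poly (of_int_poly (gap_quotient c (Suc (Suc k)))) (y :: real)
    = y * poly (of_int_poly (gap_quotient c (Suc k))) y - poly (of_int_poly (gap_quotient c k)) y"
  by (simp only: gap_quotient.simps of_int_poly_hom.hom_mult of_int_poly_hom.hom_minus poly_mult poly_diff)
    (simp add: of_int_hom.map_poly_pCons_hom algebra_simps power2_eq_square)

lemma power_gap_step:
  fixes s t :: real
  assumes "s * t = 1"
  shows "s ^ (n + 4) - t ^ (n + 4) = (s\<^sup>2 + t\<^sup>2) * (s ^ (n + 2) - t ^ (n + 2)) - (s ^ n - t ^ n)"
proof -
  have "(s\<^sup>2 + t\<^sup>2) * (s ^ (n + 2) - t ^ (n + 2))
      = s ^ (n + 4) - t ^ (n + 4) + (s * t)\<^sup>2 * (s ^ n - t ^ n)"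
    by (simp add: algebra_simps power_add power2_eq_square power4_eq_xxxx)
  then show ?thesis by (simp add: assms)
qed

lemma power_gap_odd:
  fixes s t :: real
  assumes "s * t = 1"
  shows "s ^ (2 * k + 1) - t ^ (2 * k + 1)
    = (s - t) * poly (of_int_poly (gap_quotient 1 k)) (s\<^sup>2 + t\<^sup>2)"
proof (induction "1 :: int" k rule: gap_quotient.induct)
  case 1
  show ?case by simp
next
  case 2
  have "(s - t) * (1 + (s\<^sup>2 + t\<^sup>2)) = s ^ 3 - t ^ 3 + (s - t) * (1 - s * t)"
    by (simp add: algebra_simps power2_eq_square power3_eq_cube)
  then show ?case using assms by (simp add: of_int_hom.map_poly_pCons_hom numeral_3_eq_3 power2_eq_square mult_ac)
next
  case (3 k)
  have exponents: "2 * Suc (Suc k) + 1 = (2 * k + 1) + 4" "(2 * k + 1) + 2 = 2 * Suc k + 1"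
    by simp_all
  show ?case
    unfolding exponents power_gap_step[OF assms] poly_gap_quotient_Suc_Suc 3
    by (simp add: algebra_simps del: gap_quotient.simps)
qed

lemma power_gap_even:
  fixes s t :: real
  assumes "s * t = 1"
  shows "s ^ (2 * k + 2) - t ^ (2 * k + 2)
    = (s\<^sup>2 - t\<^sup>2) * poly (of_int_poly (gap_quotient 0 k)) (s\<^sup>2 + t\<^sup>2)"
proof (induction "0 :: int" k rule: gap_quotient.induct)
  case 1
  show ?case by (simp add: power2_eq_square)
next
  case 2
  have "(s\<^sup>2 - t\<^sup>2) * (s\<^sup>2 + t\<^sup>2) = s ^ 4 - t ^ 4"
    by (simp add: algebra_simps power2_eq_square power4_eq_xxxx)
  then show ?case by (simp add: of_int_hom.map_poly_pCons_hom)
next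
  case (3 k)
  have exponents: "2 * Suc (Suc k) + 2 = (2 * k + 2) + 4" "(2 * k + 2) + 2 = 2 * Suc k + 2"
    by simp_all
  show ?case
    unfolding exponents power_gap_step[OF assms] poly_gap_quotient_Suc_Suc 3
    by (simp add: algebra_simps del: gap_quotient.simps)
qed

text \<open>
  For \<open>y \<ge> 2\<close> the recursion makes the sequence convex with a nonnegative first increment, so
  from index \<open>1\<close> on it stays above \<open>y + c \<ge> 2\<close>.
\<close>

lemma gap_quotient_ge:
  fixes y :: real
  assumes "y \<ge> 2" and "c \<ge> 0"
  shows "poly (of_int_poly (gap_quotient c (Suc k))) y \<ge> poly (of_int_poly (gap_quotient c k)) y \<and>
    poly (of_int_poly (gap_quotient c (Suc k))) y \<ge> 2"
proof (induction k)
  case 0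
  show ?case using assms by (simp add: of_int_hom.map_poly_pCons_hom)
next
  case (Suc k)
  let ?b = "poly (of_int_poly (gap_quotient c (Suc k))) y"
  have "y * ?b \<ge> 2 * ?b"
    using assms Suc by (intro mult_right_mono) auto
  then show ?case
    using Suc unfolding poly_gap_quotient_Suc_Suc by linarith
qed

section \<open>The product of the gaps\<close>

lemma prod_mset_sum_pairs:
  "finite I \<Longrightarrow> (\<Prod>x\<in>#(\<Sum>i\<in>I. {#f i, g i#}). F x) = (\<Prod>i\<in>I. F (f i) * F (g i))"
  by (induction I rule: finite_induct) (simp_all add: mult_ac)

lemma size_sum_pairs: "finite I \<Longrightarrow> size (\<Sum>i\<in>I. {#f i, g i#}) = 2 * card I"
  by (induction I rule: finite_induct) simp_all

lemma poly_prod_linear_factors: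
  fixes f :: "'b \<Rightarrow> 'a :: comm_ring_1"
  shows "poly (\<Prod>i\<in>I. [:- f i, 1:]) y = (\<Prod>i\<in>I. y - f i)"
  by (simp add: poly_prod)

context
  fixes h :: nat and \<alpha> :: "nat \<Rightarrow> real"
  assumes roots: "proots (of_int_poly (odd_d h)) = (\<Sum>i = 1..h. {#\<alpha> i, inverse (\<alpha> i)#})"
begin

lemma odd_d_root_pos:
  assumes "i \<in> {1..h}"
  shows "\<alpha> i > 0"
proof (rule ccontr)
  assume "\<not> \<alpha> i > 0"
  have "\<alpha> i \<in># proots (of_int_poly (odd_d h))"
    unfolding roots using assms by (subst sum.remove[of _ i]) auto
  moreover have "of_int_poly (odd_d h) \<noteq> (0 :: real poly)"
    using degree_odd_d[of h] by auto
  ultimately have "poly (of_int_poly (odd_d h)) (\<alpha> i) = 0"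
    by simp
  with odd_d_pos[of "\<alpha> i" h] \<open>\<not> \<alpha> i > 0\<close> show False
    by simp
qed

lemma odd_d_factored:
  "poly (of_int_poly (odd_d h)) x = (\<Prod>i = 1..h. (x - \<alpha> i) * (x - inverse (\<alpha> i)))"
proof -
  let ?D = "of_int_poly (odd_d h) :: real poly"
  have lc: "lead_coeff ?D = 1" and deg: "degree ?D = 2 * h"
    using degree_odd_d[of h] by auto
  have "?D = smult (lead_coeff ?D) (\<Prod>a\<in>#proots ?D. [:-a, 1:])"
  proof (rule poly_eq_prod_proots)
    show "?D \<noteq> 0" using lc by auto
    show "size (proots ?D) = degree ?D" unfolding roots deg by (simp add: size_sum_pairs)
  qed
  then have "?D = (\<Prod>i = 1..h. [:- \<alpha> i, 1:] * [:- inverse (\<alpha> i), 1:])"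
    unfolding roots lc by (simp add: prod_mset_sum_pairs)
  then show ?thesis
    by (simp add: poly_prod algebra_simps)
qed

text \<open>
  Pairing \<open>\<alpha>\<close> with \<open>1 / \<alpha>\<close> gives \<open>(x - \<alpha>) (x - 1 / \<alpha>) = x (x + 1 / x - (\<alpha> + 1 / \<alpha>))\<close>. Hence both sides
  agree at every \<open>y = x + 1 / x\<close> with \<open>x > 0\<close>, that is, at every real \<open>y \<ge> 2\<close>.
\<close>

lemma trace_poly_factored:
  "of_int_poly (trace_poly h) = (\<Prod>i = 1..h. [:- (\<alpha> i + inverse (\<alpha> i)), 1:])" (is "?Q = ?R")
proof (rule ccontr)
  assume "?Q \<noteq> ?R"
  then have "finite {y. poly (?Q - ?R) y = 0}"
    by (intro poly_roots_finite) simp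
  moreover have "{2..} \<subseteq> {y. poly (?Q - ?R) y = 0}"
  proof
    fix y :: real
    assume "y \<in> {2..}"
    then have y: "y\<^sup>2 - 4 \<ge> 0" "y > 0"
      using power_mono[of 2 y 2] by auto
    \<comment> \<open>the larger solution of \<open>x + 1 / x = y\<close>\<close>
    define x where "x = (y + sqrt (y\<^sup>2 - 4)) / 2"
    have x: "x > 0"
      using y by (simp add: x_def add_pos_nonneg)
    have "x * (y - x) = (y\<^sup>2 - (sqrt (y\<^sup>2 - 4))\<^sup>2) / 4"
      by (simp add: x_def field_simps power2_eq_square)
    also have "\<dots> = 1"
      using y by simp
    finally have xy: "x + inverse x = y"
      using x by (simp add: field_simps)
    have factor: "(x - \<alpha> i) * (x - inverse (\<alpha> i)) = x * (y - (\<alpha> i + inverse (\<alpha> i)))"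
      if "i \<in> {1..h}" for i
      using odd_d_root_pos[OF that] x by (simp add: xy[symmetric] field_simps)
    have "x ^ h * poly ?Q y = poly (of_int_poly (odd_d h)) x"
      using odd_d_eq_trace_poly[of x h] x by (simp add: xy)
    also have "\<dots> = (\<Prod>i = 1..h. x * (y - (\<alpha> i + inverse (\<alpha> i))))"
      unfolding odd_d_factored using factor by (rule prod.cong[OF refl])
    also have "\<dots> = x ^ h * poly ?R y"
      unfolding poly_prod_linear_factors prod.distrib by simp
    finally show "y \<in> {y. poly (?Q - ?R) y = 0}"
      using x by simp
  qed
  ultimately show False
    using infinite_Ici finite_subset by blast
qed

lemma prod_at_traces_Ints:
  "(\<Prod>i = 1..h. poly (of_int_poly p) (\<alpha> i + inverse (\<alpha> i))) \<in> \<int>"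
proof -
  define w where "w i = \<alpha> i + inverse (\<alpha> i)" for i
  have list_prod: "(\<Prod>x\<leftarrow>map w [1..<Suc h]. F x) = (\<Prod>i = 1..h. F (w i))" for F :: "real \<Rightarrow> 'b :: comm_monoid_mult"
    using prod.distinct_set_conv_list[of "[1..<Suc h]" "\<lambda>i. F (w i)"]
    by (simp add: o_def atLeastLessThanSuc_atLeastAtMost del: upt_Suc)
  have "of_int_poly (trace_poly h) = (\<Prod>x\<leftarrow>map w [1..<Suc h]. [:- x, 1:])"
    unfolding list_prod trace_poly_factored by (simp add: w_def)
  from prod_poly_at_roots_Ints[OF this, of p] show ?thesis
    unfolding list_prod by (simp add: w_def)
qed

text \<open>
  This product is \<open>d\<^sub>m(1)\<close> up to sign, and the recursion gives \<open>d\<^sub>m(1) = \<plusminus>1\<close>.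
\<close>

lemma prod_traces_minus_2: "(\<Prod>i = 1..h. \<alpha> i + inverse (\<alpha> i) - 2) = 1"
proof -
  have "(\<Prod>i = 1..h. \<alpha> i + inverse (\<alpha> i) - 2) = (\<Prod>i = 1..h. (-1) * (2 - (\<alpha> i + inverse (\<alpha> i))))"
    by simp
  also have "\<dots> = (-1) ^ h * poly (of_int_poly (trace_poly h)) 2"
    unfolding trace_poly_factored prod.distrib poly_prod_linear_factors by simp
  also have "\<dots> = 1"
    unfolding trace_poly_at_2 by (simp flip: power_mult_distrib)
  finally show ?thesis .
qed

text \<open>
  The square of a single gap is \<open>(w - 2) P(w)\<^sup>2\<close> for odd \<open>n\<close> and \<open>(w - 2) (w + 2) P(w)\<^sup>2\<close> for
  even \<open>n\<close>, where \<open>w = \<alpha> + 1 / \<alpha>\<close> and \<open>P\<close> is a gap quotient. Over all pairs the factors \<open>w - 2\<close>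
  multiply to \<open>1\<close>, the factors \<open>w + 2\<close> to an integer \<open>W\<close> and the \<open>P(w)\<close> to an integer \<open>N \<ge> 2\<close>.
\<close>

lemma gap_product_not_prime:
  assumes "h \<ge> 1" and "n \<ge> 3"
  shows "\<exists>G :: nat. real G = (\<Prod>i = 1..h. \<alpha> i powr (real n / 2) - \<alpha> i powr (- (real n / 2)))\<^sup>2
    \<and> 1 < G \<and> \<not> prime G"
proof -
  define w where "w i = \<alpha> i + inverse (\<alpha> i)" for i
  define s where "s i = \<alpha> i powr (1 / 2)" for i
  define t where "t i = \<alpha> i powr (- (1 / 2))" for i
  have w_ge_2: "w i \<ge> 2" if "i \<in> {1..h}" for i
  proof -
    have "w i - 2 = (\<alpha> i - 1)\<^sup>2 / \<alpha> i"
      using odd_d_root_pos[OF that] by (simp add: w_def field_simps power2_eq_square)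
    moreover have "\<dots> \<ge> 0"
      using odd_d_root_pos[OF that] by simp
    ultimately show ?thesis by simp
  qed
  have s_power: "s i ^ j = \<alpha> i powr (real j / 2)"
    and t_power: "t i ^ j = \<alpha> i powr (- (real j / 2))" if "i \<in> {1..h}" for i j
    using odd_d_root_pos[OF that] by (simp_all add: s_def t_def powr_power)
  have st: "s i * t i = 1" and w_eq: "(s i)\<^sup>2 + (t i)\<^sup>2 = w i" if "i \<in> {1..h}" for i
    using odd_d_root_pos[OF that] s_power[OF that, of 2] t_power[OF that, of 2]
    by (simp_all add: s_def t_def w_def powr_minus)
  \<comment> \<open>\<open>a\<close> records whether the factor \<open>w + 2\<close> is present, so that both parities are treated at once\<close>
  obtain k c a where ck: "(c :: int) \<ge> 0" "k \<ge> 1" and a: "a \<in> {0, 1 :: nat}"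
    and gap_sq: "\<And>i. i \<in> {1..h} \<Longrightarrow>
      (s i ^ n - t i ^ n)\<^sup>2 = (w i - 2) * (w i + 2) ^ a * (poly (of_int_poly (gap_quotient c k)) (w i))\<^sup>2"
  proof (cases "odd n")
    case True
    then obtain k where k: "n = 2 * k + 1" by (elim oddE)
    show ?thesis
    proof (rule that[of 1 k 0])
      fix i assume i: "i \<in> {1..h}"
      have "(s i - t i)\<^sup>2 = w i - 2"
        using st[OF i] w_eq[OF i] by (simp add: power2_diff)
      then show "(s i ^ n - t i ^ n)\<^sup>2
          = (w i - 2) * (w i + 2) ^ 0 * (poly (of_int_poly (gap_quotient 1 k)) (w i))\<^sup>2"
        unfolding k power_gap_odd[OF st[OF i]] w_eq[OF i] by (simp add: power_mult_distrib)
    qed (use k assms in auto)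
  next
    case False
    then obtain j where j: "n = 2 * j" by (auto elim: evenE)
    define k where "k = j - 1"
    have k: "n = 2 * k + 2" "k \<ge> 1"
      using j assms by (auto simp: k_def)
    show ?thesis
    proof (rule that[of 0 k 1])
      fix i assume i: "i \<in> {1..h}"
      have "((s i)\<^sup>2 - (t i)\<^sup>2)\<^sup>2 = ((s i)\<^sup>2 + (t i)\<^sup>2)\<^sup>2 - 4 * (s i * t i)\<^sup>2"
        by (simp add: algebra_simps power2_eq_square)
      also have "\<dots> = (w i - 2) * (w i + 2)"
        unfolding w_eq[OF i] st[OF i] by (simp add: algebra_simps power2_eq_square)
      finally show "(s i ^ n - t i ^ n)\<^sup>2
          = (w i - 2) * (w i + 2) ^ 1 * (poly (of_int_poly (gap_quotient 0 k)) (w i))\<^sup>2"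
        unfolding k power_gap_even[OF st[OF i]] w_eq[OF i] by (simp add: power_mult_distrib)
    qed (use k in auto)
  qed
  define P where "P i = poly (of_int_poly (gap_quotient c k)) (w i)" for i
  have P_ge_2: "P i \<ge> 2" if "i \<in> {1..h}" for i
    using gap_quotient_ge[OF w_ge_2[OF that] ck(1), of "k - 1"] ck(2) by (simp add: P_def)
  have "(\<Prod>i = 1..h. P i) \<ge> (\<Prod>i = 1..h. 2)"
    using P_ge_2 by (intro prod_mono) auto
  moreover have "(2 :: real) ^ 1 \<le> 2 ^ h"
    using assms by (intro power_increasing) auto
  ultimately have P_prod: "(\<Prod>i = 1..h. P i) \<ge> 2"
    by simp
  moreover have "(\<Prod>i = 1..h. P i) \<in> \<int>"
    unfolding P_def w_def by (rule prod_at_traces_Ints)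
  ultimately obtain N :: nat where N: "real N = (\<Prod>i = 1..h. P i)"
    by (metis Ints_cases int_nat_eq of_int_0_le_iff of_int_of_nat_eq order_trans zero_le_numeral)
  have W_prod: "(\<Prod>i = 1..h. w i + 2) \<ge> (\<Prod>i = 1..h. 1)"
    using w_ge_2 by (intro prod_mono) fastforce
  moreover have "(\<Prod>i = 1..h. w i + 2) \<in> \<int>"
    using prod_at_traces_Ints[of "[:2, 1:]"] by (simp add: of_int_hom.map_poly_pCons_hom w_def add_ac)
  ultimately obtain W :: nat where W: "real W = (\<Prod>i = 1..h. w i + 2)"
    by (metis Ints_cases int_nat_eq of_int_0_le_iff of_int_of_nat_eq order_trans prod.neutral_const zero_le_one)
  have "N \<ge> 2" "W \<ge> 1"
    using N W P_prod W_prod by simp_all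
  then have factors: "W ^ a * N \<ge> 2"
    by (metis One_nat_def Suc_le_eq mult_le_mono nat_mult_1 one_le_power)
  have "(\<Prod>i = 1..h. \<alpha> i powr (real n / 2) - \<alpha> i powr (- (real n / 2)))\<^sup>2
      = (\<Prod>i = 1..h. (w i - 2) * (w i + 2) ^ a * (P i)\<^sup>2)"
    unfolding prod_power_distrib using gap_sq by (intro prod.cong) (simp_all add: P_def flip: s_power t_power)
  also have "\<dots> = (\<Prod>i = 1..h. w i - 2) * real W ^ a * (real N)\<^sup>2"
    by (simp only: prod.distrib prod_power_distrib[symmetric] W N)
  also have "\<dots> = real ((W ^ a * N) * N)"
    using prod_traces_minus_2 by (simp add: w_def power2_eq_square)
  finally have "real ((W ^ a * N) * N)
      = (\<Prod>i = 1..h. \<alpha> i powr (real n / 2) - \<alpha> i powr (- (real n / 2)))\<^sup>2" ..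
  moreover have "\<not> prime ((W ^ a * N) * N)"
    using prime_product[of "W ^ a * N" N] factors \<open>N \<ge> 2\<close> by auto
  moreover have "1 < (W ^ a * N) * N"
    using mult_le_mono[OF factors \<open>N \<ge> 2\<close>] by simp
  ultimately show ?thesis by blast
qed

end

theorem theorem5:
  fixes m n :: nat and \<alpha> :: "nat \<Rightarrow> real"
  assumes "m \<ge> 3" and "n \<ge> 3" and "odd m"
    and "proots (map_poly real_of_int (fox_d m)) =
           (\<Sum>i = 1..(m - 1) div 2. {#\<alpha> i, inverse (\<alpha> i)#})"
  shows "\<exists>G :: nat.
           real G = (\<Prod>i = 1..(m - 1) div 2.
                       \<alpha> i powr (real n / 2) - \<alpha> i powr (- (real n / 2)))\<^sup>2
           \<and> 1 < G \<and> \<not> prime G"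
proof -
  obtain h where m: "m = Suc (2 * h)"
    using \<open>odd m\<close> by (metis Suc_eq_plus1 oddE)
  have half: "(m - 1) div 2 = h"
    by (simp add: m)
  have "h \<ge> 1"
    using \<open>m \<ge> 3\<close> by (simp add: m)
  from gap_product_not_prime[OF _ this \<open>n \<ge> 3\<close>] assms(4) show ?thesis
    unfolding half unfolding m fox_d_odd by blast
qed

end
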